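(* Let $n\ge 2$. Then $\operatorname{rank}\mathcal{SS}'_n=3n-4$.
   Context: Let $[n]=\{1,2,\dots,n\}$ with its usual order. $\mathcal{P}_n$ is the semigroup of all partial transformations of $[n]$ (maps whose domain and image are subsets of $[n]$, including the empty map), composed from left to right: $x(\alpha\beta)=(x\alpha)\beta$. A partial map $\alpha$ is isotone if $x\le y$ implies $x\alpha\le y\alpha$ for all $x,y\in\mathrm{Dom}\,\alpha$, and order-decreasing if $x\alpha\le x$ for all $x\in\mathrm{Dom}\,\alpha$. $\mathcal{LS}_n$ is the monoid of all isotone order-decreasing $\alpha\in\mathcal{P}_n$, and $\mathcal{SS}'_n=\{\alpha\in\mathcal{LS}_n: 1\notin \mathrm{Dom}\,\alpha\}$, a subsemigroup of $\mathcal{LS}_n$. The rank of a finitely generated semigroup $S$ is $\operatorname{rank}(S)=\min\{|A|: A\subseteq S,\ \langle A\rangle=S\}$, where $\langle A\rangle$ is the subsemigroup generated by $A$. *)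

theory Defs
  imports Main
begin

inductive_set subsemigroup_gen :: "('a \<Rightarrow> 'a \<Rightarrow> 'a) \<Rightarrow> 'a set \<Rightarrow> 'a set"
  for f :: "'a \<Rightarrow> 'a \<Rightarrow> 'a" and A :: "'a set" where
  base: "a \<in> A \<Longrightarrow> a \<in> subsemigroup_gen f A"
| mult: "a \<in> subsemigroup_gen f A \<Longrightarrow> b \<in> subsemigroup_gen f A \<Longrightarrow> f a b \<in> subsemigroup_gen f A"

text \<open>Only finite generating sets are considered, since \<open>card\<close> is \<open>0\<close> on infinite sets.
  The value is meaningful only for finitely generated \<open>S\<close>.\<close>

definition semigroup_rank :: "('a \<Rightarrow> 'a \<Rightarrow> 'a) \<Rightarrow> 'a set \<Rightarrow> nat" where
  "semigroup_rank f S = Inf {card A |A. finite A \<and> A \<subseteq> S \<and> subsemigroup_gen f A = S}"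

definition partial_transformations :: "nat \<Rightarrow> (nat \<rightharpoonup> nat) set" where
  "partial_transformations n = {\<alpha>. dom \<alpha> \<subseteq> {1..n} \<and> ran \<alpha> \<subseteq> {1..n}}"

text \<open>Composition from left to right: \<open>\<alpha>\<close> is applied first, whereas \<open>\<circ>\<^sub>m\<close> applies
  its right argument first.\<close>

definition pt_comp :: "(nat \<rightharpoonup> nat) \<Rightarrow> (nat \<rightharpoonup> nat) \<Rightarrow> (nat \<rightharpoonup> nat)" where
  "pt_comp \<alpha> \<beta> = \<beta> \<circ>\<^sub>m \<alpha>"

definition isotone :: "(nat \<rightharpoonup> nat) \<Rightarrow> bool" where
  "isotone \<alpha> \<longleftrightarrow> (\<forall>x\<in>dom \<alpha>. \<forall>y\<in>dom \<alpha>. x \<le> y \<longrightarrow> the (\<alpha> x) \<le> the (\<alpha> y))"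

definition order_decreasing :: "(nat \<rightharpoonup> nat) \<Rightarrow> bool" where
  "order_decreasing \<alpha> \<longleftrightarrow> (\<forall>x\<in>dom \<alpha>. the (\<alpha> x) \<le> x)"

definition LS :: "nat \<Rightarrow> (nat \<rightharpoonup> nat) set" where
  "LS n = {\<alpha> \<in> partial_transformations n. isotone \<alpha> \<and> order_decreasing \<alpha>}"

definition SS' :: "nat \<Rightarrow> (nat \<rightharpoonup> nat) set" where
  "SS' n = {\<alpha> \<in> LS n. 1 \<notin> dom \<alpha>}"

end

theory Submission imports Defs begin

text \<open>The elements of \<open>SS' n\<close> that are irreducible, in the sense that \<open>g = \<beta>\<gamma>\<close> forces
  \<open>\<beta> = g\<close> or \<open>\<gamma> = g\<close>, lie in every generating set. The identity of \<open>{2..n}\<close>, the maps lowering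
  an initial segment \<open>{2..k}\<close> by one, and the maps deleting or lowering a single point \<open>k \<ge> 3\<close> are
  of this kind, and there are \<open>1 + (n - 1) + (n - 2) + (n - 2)\<close> of them. Conversely they generate:
  unless \<open>\<alpha>\<close> is total and injective on \<open>{2..n}\<close>, in which case it lowers an initial segment, one can
  split off on the left a generator that deletes or lowers one point, leaving a factor that is
  closer to the identity.\<close>

section \<open>Pointwise description of \<open>SS' n\<close> and closure under composition\<close>

lemma SS'_iff:
  "\<alpha> \<in> SS' n \<longleftrightarrow> (\<forall>x y. \<alpha> x = Some y \<longrightarrow> 2 \<le> x \<and> x \<le> n \<and> 1 \<le> y \<and> y \<le> x) \<and>
    (\<forall>x y u v. \<alpha> x = Some u \<longrightarrow> \<alpha> y = Some v \<longrightarrow> x \<le> y \<longrightarrow> u \<le> v)"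
  (is "?L \<longleftrightarrow> ?B \<and> ?M")
proof
  assume L: ?L
  have B: ?B
  proof (intro allI impI)
    fix x y assume xy: "\<alpha> x = Some y"
    have "x \<in> {1..n}" "y \<in> {1..n}"
      using L xy by (auto simp: SS'_def LS_def partial_transformations_def intro: domI ranI)
    moreover have "x \<noteq> 1" using L xy by (auto simp: SS'_def)
    moreover have "the (\<alpha> x) \<le> x"
      using L domI[of \<alpha> x y, OF xy] unfolding SS'_def LS_def order_decreasing_def by blast
    ultimately show "2 \<le> x \<and> x \<le> n \<and> 1 \<le> y \<and> y \<le> x" using xy by auto
  qed
  have ?M using L by (force simp: SS'_def LS_def isotone_def)
  with B show "?B \<and> ?M" by blast
next
  assume "?B \<and> ?M"
  then have B: "\<And>x y. \<alpha> x = Some y \<Longrightarrow> 2 \<le> x \<and> x \<le> n \<and> 1 \<le> y \<and> y \<le> x" and M: ?M by blast+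
  have "dom \<alpha> \<subseteq> {1..n}" using B by fastforce
  moreover have "ran \<alpha> \<subseteq> {1..n}" using B by (fastforce simp: ran_def)
  moreover have "isotone \<alpha>" using M by (fastforce simp: isotone_def)
  moreover have "order_decreasing \<alpha>" using B by (fastforce simp: order_decreasing_def)
  moreover have "1 \<notin> dom \<alpha>" using B by fastforce
  ultimately show ?L by (simp add: SS'_def LS_def partial_transformations_def)
qed

lemma SS'_bounds:
  assumes "\<alpha> \<in> SS' n" "\<alpha> x = Some y"
  shows "2 \<le> x" "x \<le> n" "1 \<le> y" "y \<le> x"
  using assms by (auto simp: SS'_iff)

lemma SS'_mono: "\<alpha> \<in> SS' n \<Longrightarrow> \<alpha> x = Some u \<Longrightarrow> \<alpha> y = Some v \<Longrightarrow> x \<le> y \<Longrightarrow> u \<le> v"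
  by (auto simp: SS'_iff)

lemma pt_comp_eq_Some_iff: "pt_comp \<alpha> \<beta> x = Some z \<longleftrightarrow> (\<exists>y. \<alpha> x = Some y \<and> \<beta> y = Some z)"
  by (simp add: pt_comp_def map_comp_Some_iff)

lemma pt_comp_SS': "\<alpha> \<in> SS' n \<Longrightarrow> \<beta> \<in> SS' n \<Longrightarrow> pt_comp \<alpha> \<beta> \<in> SS' n"
  unfolding SS'_iff pt_comp_eq_Some_iff by (meson order_trans)

section \<open>The candidate generators and their number\<close>

definition idp :: "nat \<Rightarrow> nat \<rightharpoonup> nat" where
  "idp n = (\<lambda>x. if 2 \<le> x \<and> x \<le> n then Some x else None)"

definition shift :: "nat \<Rightarrow> nat \<Rightarrow> nat \<rightharpoonup> nat" where
  "shift n k = (\<lambda>x. if 2 \<le> x \<and> x \<le> n then Some (if x \<le> k then x - 1 else x) else None)"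

definition del :: "nat \<Rightarrow> nat \<Rightarrow> nat \<rightharpoonup> nat" where
  "del n k = (idp n)(k := None)"

text \<open>For n \<ge> 2, \<open>low n 2\<close> is \<open>shift n 2\<close> again, and
  \<open>del n 2\<close> is the square of \<open>shift n 2\<close>; hence both one-point families
  enter \<open>gens n\<close> only from k = 3 on.\<close>

definition low :: "nat \<Rightarrow> nat \<Rightarrow> nat \<rightharpoonup> nat" where
  "low n k = (idp n)(k := Some (k - 1))"

text \<open>The identity of \<open>{2..n}\<close> enters as \<open>shift n 1\<close>.\<close>

definition gens :: "nat \<Rightarrow> (nat \<rightharpoonup> nat) set" where
  "gens n = shift n ` {1..n} \<union> del n ` {3..n} \<union> low n ` {3..n}"

lemma gens_subset_SS': "gens n \<subseteq> SS' n"
proof -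
  have "shift n k \<in> SS' n" for k
    by (auto simp: SS'_iff shift_def split: if_splits)
  moreover have "del n k \<in> SS' n" for k
    by (auto simp: SS'_iff del_def idp_def split: if_splits)
  moreover have "low n k \<in> SS' n" if "k \<in> {3..n}" for k
    using that by (auto simp: SS'_iff low_def idp_def split: if_splits)
  ultimately show ?thesis by (auto simp: gens_def)
qed

lemma finite_gens: "finite (gens n)"
  by (simp add: gens_def)

lemma card_gens:
  assumes "n \<ge> 2"
  shows "card (gens n) = 3 * n - 4"
proof -
  have shift_ne: "shift n j \<noteq> shift n k" if "j < k" "j \<ge> 1" "k \<le> n" for j k
  proof
    assume "shift n j = shift n k"
    then have "shift n j k = shift n k k" by simp
    with that show False by (auto simp: shift_def)
  qed
  have i1: "inj_on (shift n) {1..n}"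
    by (rule inj_onI) (metis atLeastAtMost_iff linorder_neqE_nat shift_ne)
  have i2: "inj_on (del n) {3..n}"
  proof (rule inj_onI)
    fix j k assume k: "k \<in> {3..n}" and eq: "del n j = del n k"
    have "del n j k = None" unfolding eq by (simp add: del_def)
    with k show "j = k" by (auto simp: del_def idp_def split: if_splits)
  qed
  have i3: "inj_on (low n) {3..n}"
  proof (rule inj_onI)
    fix j k assume k: "k \<in> {3..n}" and eq: "low n j = low n k"
    have "low n j k = Some (k - 1)" unfolding eq by (simp add: low_def)
    with k show "j = k" by (auto simp: low_def idp_def split: if_splits)
  qed
  have d12: "shift n j \<noteq> del n k" if "k \<in> {3..n}" for j k
  proof
    assume "shift n j = del n k"
    then have "shift n j k = del n k k" by simp
    with that show False by (auto simp: del_def shift_def)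
  qed
  have d32: "low n j \<noteq> del n k" if "k \<in> {3..n}" for j k
  proof
    assume "low n j = del n k"
    then have "low n j k = del n k k" by simp
    with that show False by (auto simp: del_def low_def idp_def split: if_splits)
  qed
  have d13: "shift n j \<noteq> low n k" if "k \<in> {3..n}" for j k
  proof
    assume "shift n j = low n k"
    \<comment> \<open>Since k \<ge> 3, the point 2 is fixed by \<open>low n k\<close>. This forces j
      < 2, so \<open>shift n j\<close> fixes k as well, whereas \<open>low n k\<close> moves
      it.\<close>
    then have "shift n j 2 = low n k 2" "shift n j k = low n k k" by simp_all
    with that show False by (auto simp: low_def shift_def idp_def split: if_splits)
  qed
  have "shift n ` {1..n} \<inter> del n ` {3..n} = {}"
    "(shift n ` {1..n} \<union> del n ` {3..n}) \<inter> low n ` {3..n} = {}"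
    using d12 d13 d32 by (auto dest: sym)
  then have "card (gens n) = card (shift n ` {1..n}) + card (del n ` {3..n}) + card (low n ` {3..n})"
    by (simp add: gens_def card_Un_disjoint)
  also have "\<dots> = n + (n - 2) + (n - 2)"
    using i1 i2 i3 by (simp add: card_image)
  finally show ?thesis using assms by simp
qed

section \<open>Irreducibility of the generators\<close>

lemma SS'_eq_idpI:
  assumes "\<alpha> \<in> SS' n" "\<And>x. 2 \<le> x \<Longrightarrow> x \<le> n \<Longrightarrow> \<alpha> x = Some x"
  shows "\<alpha> = idp n"
proof
  fix x show "\<alpha> x = idp n x"
    using assms(2)[of x] SS'_bounds[OF assms(1), of x] by (cases "\<alpha> x") (auto simp: idp_def)
qed

lemma SS'_eq_updI:
  assumes "\<alpha> \<in> SS' n" "\<And>x. 2 \<le> x \<Longrightarrow> x \<le> n \<Longrightarrow> x \<noteq> k \<Longrightarrow> \<alpha> x = Some x"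
  shows "\<alpha> = (idp n)(k := \<alpha> k)"
proof
  fix x show "\<alpha> x = ((idp n)(k := \<alpha> k)) x"
    using assms(2)[of x] SS'_bounds[OF assms(1), of x] by (cases "\<alpha> x") (auto simp: idp_def)
qed

text \<open>There is no such law on the right: a right factor \<open>idp n\<close> deletes every
  point with value 1.\<close>

lemma pt_comp_idp_left: "\<alpha> \<in> SS' n \<Longrightarrow> pt_comp (idp n) \<alpha> = \<alpha>"
proof
  fix x assume "\<alpha> \<in> SS' n"
  then show "pt_comp (idp n) \<alpha> x = \<alpha> x"
    using SS'_bounds[of \<alpha> n x] by (cases "\<alpha> x") (auto simp: pt_comp_def map_comp_def idp_def)
qed

text \<open>Both factors are order-decreasing, so the intermediate value is squeezed between x and
  x.\<close>

lemma factors_fix: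
  assumes "\<beta> \<in> SS' n" "\<gamma> \<in> SS' n" "pt_comp \<beta> \<gamma> x = Some x"
  shows "\<beta> x = Some x" "\<gamma> x = Some x"
proof -
  obtain y where y: "\<beta> x = Some y" "\<gamma> y = Some x"
    using assms(3) by (auto simp: pt_comp_eq_Some_iff)
  then have "y = x" using SS'_bounds assms(1,2) by (metis le_antisym)
  with y show "\<beta> x = Some x" "\<gamma> x = Some x" by simp_all
qed

lemma shift_irreducible:
  assumes "\<beta> \<in> SS' n" "\<gamma> \<in> SS' n" and eq: "pt_comp \<beta> \<gamma> = shift n k"
  shows "\<beta> = shift n k \<or> \<gamma> = shift n k"
proof -
  text \<open>Since \<open>1\<close> is outside the domain of \<open>\<gamma>\<close>, \<open>\<beta>\<close> must fix \<open>2\<close>; injectivity of the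
    product then propagates this upwards.\<close>
  have "\<beta> x = Some x" if "2 \<le> x" "x \<le> n" for x
    using that
  proof (induction x rule: nat_induct_at_least)
    case base
    then obtain z where "pt_comp \<beta> \<gamma> 2 = Some z" unfolding eq by (simp add: shift_def)
    then obtain y where y: "\<beta> 2 = Some y" "\<gamma> y = Some z" by (auto simp: pt_comp_eq_Some_iff)
    then have "y = 2" using SS'_bounds[OF assms(1) y(1)] SS'_bounds[OF assms(2) y(2)] by simp
    with y show ?case by simp
  next
    case (Suc x)
    then have x: "\<beta> x = Some x" by simp
    from Suc obtain z where z: "pt_comp \<beta> \<gamma> (Suc x) = Some z" unfolding eq by (simp add: shift_def)
    then obtain y where y: "\<beta> (Suc x) = Some y" "\<gamma> y = Some z" by (auto simp: pt_comp_eq_Some_iff)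
    have "x \<le> y" using SS'_mono[OF assms(1) x y(1)] by simp
    moreover have "y \<le> Suc x" using SS'_bounds[OF assms(1) y(1)] by simp
    moreover have "y \<noteq> x"
    proof
      assume "y = x"
      then have "pt_comp \<beta> \<gamma> x = pt_comp \<beta> \<gamma> (Suc x)" using x y by (simp add: pt_comp_def map_comp_def)
      then show False unfolding eq using Suc by (auto simp: shift_def split: if_splits)
    qed
    ultimately show ?case using y by (simp add: le_Suc_eq)
  qed
  then have "\<beta> = idp n" using SS'_eq_idpI assms(1) by blast
  then show ?thesis using eq pt_comp_idp_left[OF assms(2)] by simp
qed

text \<open>Every point of {2..n} other than k is fixed by both factors, so only \<beta> at k is
  open. As k \<ge> 3, the point k - 1 is among the fixed ones, and isotonicity leaves three cases:
  undefined, k - 1 or k. In the first two \<beta> is already the product; in the last \<beta> is the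
  identity and \<gamma> is the product.\<close>

lemma upd_irreducible:
  assumes "\<beta> \<in> SS' n" "\<gamma> \<in> SS' n" "k \<in> {3..n}"
    and eq: "pt_comp \<beta> \<gamma> = (idp n)(k := v)" and v: "v = None \<or> v = Some (k - 1)"
  shows "\<beta> = (idp n)(k := v) \<or> \<gamma> = (idp n)(k := v)"
proof -
  have fix_ne: "\<beta> x = Some x" "\<gamma> x = Some x" if "2 \<le> x" "x \<le> n" "x \<noteq> k" for x
    using factors_fix[OF assms(1,2), of x] that by (simp_all add: eq idp_def)
  then have \<beta>: "\<beta> = (idp n)(k := \<beta> k)" using SS'_eq_updI[OF assms(1)] by blast
  show ?thesis
  proof (cases "\<beta> k")
    case None
    then have "pt_comp \<beta> \<gamma> k = None" by (simp add: pt_comp_def map_comp_def)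
    then show ?thesis using \<beta> None by (simp add: eq)
  next
    case (Some y)
    have pred: "\<beta> (k - 1) = Some (k - 1)" "\<gamma> (k - 1) = Some (k - 1)"
      using fix_ne[of "k - 1"] assms(3) by auto
    have "k - 1 \<le> y" using SS'_mono[OF assms(1) pred(1) Some] by simp
    moreover have "y \<le> k" using SS'_bounds[OF assms(1) Some] by simp
    ultimately consider "y = k - 1" | "y = k" by linarith
    then show ?thesis
    proof cases
      case 1
      then have "pt_comp \<beta> \<gamma> k = Some (k - 1)" using Some pred by (simp add: pt_comp_def map_comp_def)
      then show ?thesis using \<beta> Some 1 by (simp add: eq)
    next
      case 2
      then have "\<beta> = idp n" using SS'_eq_idpI[OF assms(1)] fix_ne Some by metis
      then show ?thesis using eq pt_comp_idp_left[OF assms(2)] by simp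
    qed
  qed
qed

lemma gens_irreducible:
  assumes "\<beta> \<in> SS' n" "\<gamma> \<in> SS' n" "pt_comp \<beta> \<gamma> \<in> gens n"
  shows "\<beta> = pt_comp \<beta> \<gamma> \<or> \<gamma> = pt_comp \<beta> \<gamma>"
proof -
  consider k where "pt_comp \<beta> \<gamma> = shift n k"
    | k where "k \<in> {3..n}" "pt_comp \<beta> \<gamma> = (idp n)(k := None)"
    | k where "k \<in> {3..n}" "pt_comp \<beta> \<gamma> = (idp n)(k := Some (k - 1))"
    using assms(3) unfolding gens_def del_def low_def by blast
  then show ?thesis
  proof cases
    case 1 then show ?thesis using shift_irreducible[OF assms(1,2)] by metis
  next
    case 2 then show ?thesis using upd_irreducible[OF assms(1,2)] by metis
  next
    case 3 then show ?thesis using upd_irreducible[OF assms(1,2)] by metis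
  qed
qed

text \<open>A product in I equals one of its factors, and the induction hypothesis places that
  factor in A. Membership in S is carried through the induction because irreducibility is assumed
  only for factors in S.\<close>

lemma irreducible_in_generating_set:
  assumes closed: "\<And>a b. a \<in> S \<Longrightarrow> b \<in> S \<Longrightarrow> f a b \<in> S"
    and irr: "\<And>a b. a \<in> S \<Longrightarrow> b \<in> S \<Longrightarrow> f a b \<in> I \<Longrightarrow> a = f a b \<or> b = f a b"
    and A: "A \<subseteq> S" and g: "g \<in> subsemigroup_gen f A" "g \<in> I"
  shows "g \<in> A"
proof -
  have "g \<in> S \<and> (g \<in> I \<longrightarrow> g \<in> A)"
    using g(1)
  proof induction
    case (base a) then show ?case using A by blast
  next
    case (mult a b)
    have "f a b \<in> A" if fI: "f a b \<in> I"
      using irr[OF _ _ fI]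
    proof
      assume "a = f a b"
      then show ?thesis using mult.IH(1) fI by simp
    next
      assume "b = f a b"
      then show ?thesis using mult.IH(2) fI by simp
    qed (use mult.IH in simp_all)
    moreover have "f a b \<in> S" using mult.IH by (simp add: closed)
    ultimately show ?case by blast
  qed
  with g(2) show ?thesis by blast
qed

section \<open>Generation of \<open>SS' n\<close> by \<open>gens n\<close>\<close>

lemma subsemigroup_gen_subset:
  assumes "\<And>a b. a \<in> S \<Longrightarrow> b \<in> S \<Longrightarrow> f a b \<in> S" "A \<subseteq> S"
  shows "subsemigroup_gen f A \<subseteq> S"
proof
  fix x assume "x \<in> subsemigroup_gen f A"
  then show "x \<in> S" by induction (use assms in blast)+
qed

text \<open>The values increase strictly, starting from at least 1 at the point 2, so each x goes to
  x - 1 or x. Once a point is fixed, strictness fixes all later ones, so the lowered points form an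
  initial segment {2..k}.\<close>

lemma injective_SS'_in_gens:
  assumes \<alpha>: "\<alpha> \<in> SS' n" and "n \<ge> 2"
    and total: "\<And>x. 2 \<le> x \<Longrightarrow> x \<le> n \<Longrightarrow> \<alpha> x \<noteq> None"
    and inj: "\<And>x. 2 \<le> x \<Longrightarrow> Suc x \<le> n \<Longrightarrow> \<alpha> (Suc x) \<noteq> \<alpha> x"
  shows "\<alpha> \<in> gens n"
proof -
  define h where "h x = the (\<alpha> x)" for x
  have h: "\<alpha> x = Some (h x)" if "2 \<le> x" "x \<le> n" for x
    using total[OF that] by (auto simp: h_def)
  have bd: "1 \<le> h x" "h x \<le> x" if "2 \<le> x" "x \<le> n" for x
    using SS'_bounds[OF \<alpha> h[OF that]] by auto
  have strict: "h x < h (Suc x)" if "2 \<le> x" "Suc x \<le> n" for x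
  proof -
    have "\<alpha> x = Some (h x)" "\<alpha> (Suc x) = Some (h (Suc x))" using h that by auto
    then show ?thesis using SS'_mono[OF \<alpha>, of x "h x" "Suc x"] inj[of x] that
      by (simp add: order_less_le)
  qed
  have lower: "x - 1 \<le> h x" if "2 \<le> x" "x \<le> n" for x
    using that
  proof (induction x rule: nat_induct_at_least)
    case base then show ?case using bd by simp
  next
    case (Suc x) then show ?case using strict[of x] by simp
  qed
  have up: "h y = y" if "2 \<le> x" "x \<le> y" "y \<le> n" "h x = x" for x y
    using that(2,3)
  proof (induction y rule: dec_induct)
    case base then show ?case using that by simp
  next
    case (step y)
    then have "h y = y" by simp
    then show ?case using \<open>2 \<le> x\<close> step(1,4) bd(2)[of "Suc y"] strict[of y] by simp
  qed
  define K where "K = {x \<in> {2..n}. h x < x}"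
  \<comment> \<open>The default 1 covers the case that no point is lowered, where
    \<open>shift n 1\<close> is the identity.\<close>
  define k where "k = Max (insert 1 K)"
  have fin: "finite (insert 1 K)" by (simp add: K_def)
  then have k: "k \<in> insert 1 K" "\<And>x. x \<in> K \<Longrightarrow> x \<le> k"
    unfolding k_def by (rule Max_in, simp) (use fin in simp)
  have kn: "k \<in> {1..n}" using k(1) \<open>n \<ge> 2\<close> by (auto simp: K_def)
  have hk: "h x = (if x \<le> k then x - 1 else x)" if x: "2 \<le> x" "x \<le> n" for x
  proof (cases "x \<le> k")
    case True
    \<comment> \<open>Here k \<ge> x \<ge> 2, so k is not the default but a lowered point; if x were
      fixed, \<open>up\<close> would fix k too.\<close>
    then have "h k < k" using k(1) x by (auto simp: K_def)
    then have "h x \<noteq> x" using up[of x k] x True kn by auto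
    then show ?thesis using True lower[OF x] bd[OF x] by simp
  next
    case False
    then have "x \<notin> K" using k(2) by auto
    then show ?thesis using False x bd[OF x] by (simp add: K_def)
  qed
  have "\<alpha> x = shift n k x" for x
  proof (cases "2 \<le> x \<and> x \<le> n")
    case True
    then show ?thesis by (simp add: h hk shift_def)
  next
    case False
    then show ?thesis using SS'_bounds[OF \<alpha>, of x] by (cases "\<alpha> x") (auto simp: shift_def)
  qed
  then have "\<alpha> = shift n k" by (rule ext)
  with kn show ?thesis by (auto simp: gens_def)
qed

text \<open>An undefined point counts as value 0, below every admissible value, so filling a gap
  decreases the sum just as raising a value does.\<close>

definition defect :: "nat \<Rightarrow> (nat \<rightharpoonup> nat) \<Rightarrow> nat" where
  "defect n \<alpha> = (\<Sum>x\<in>{2..n}. x - (case \<alpha> x of None \<Rightarrow> 0 | Some y \<Rightarrow> y))"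

lemma defect_upd_less:
  assumes "k \<in> {2..n}" "y \<le> k" "(case \<alpha> k of None \<Rightarrow> 0 | Some z \<Rightarrow> z) < y"
  shows "defect n (\<alpha>(k := Some y)) < defect n \<alpha>"
  unfolding defect_def
proof (rule sum_strict_mono_ex1)
  show "\<exists>x\<in>{2..n}. x - (case (\<alpha>(k := Some y)) x of None \<Rightarrow> 0 | Some y \<Rightarrow> y)
      < x - (case \<alpha> x of None \<Rightarrow> 0 | Some y \<Rightarrow> y)"
    using assms by (intro bexI[of _ k]) auto
qed (use assms in auto)

lemma SS'_upd:
  assumes "\<alpha> \<in> SS' n" "k \<in> {2..n}" "1 \<le> y" "y \<le> k"
    and "\<And>x u. x < k \<Longrightarrow> \<alpha> x = Some u \<Longrightarrow> u \<le> y"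
    and "\<And>x u. k < x \<Longrightarrow> \<alpha> x = Some u \<Longrightarrow> y \<le> u"
  shows "\<alpha>(k := Some y) \<in> SS' n"
  unfolding SS'_iff
proof (intro conjI allI impI)
  fix x z assume "(\<alpha>(k := Some y)) x = Some z"
  then show "2 \<le> x" "x \<le> n" "1 \<le> z" "z \<le> x"
    using assms(2-4) SS'_bounds[OF assms(1), of x z] by (auto split: if_splits)
next
  fix x z u v
  assume "(\<alpha>(k := Some y)) x = Some u" "(\<alpha>(k := Some y)) z = Some v" "x \<le> z"
  then show "u \<le> v"
    using SS'_mono[OF assms(1), of x u z v] assms(5)[of x u] assms(6)[of z v]
    by (auto split: if_splits)
qed

lemma split_off_deletion:
  assumes \<alpha>: "\<alpha> \<in> SS' n" and k: "k \<in> {2..n}" and None: "\<alpha> k = None"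
  shows "\<exists>g\<in>gens n. \<exists>\<beta>\<in>SS' n. \<alpha> = pt_comp g \<beta> \<and> defect n \<beta> < defect n \<alpha>"
proof -
  \<comment> \<open>The least value that keeps the map isotone when k is added to its domain; 1 is
    the default if nothing below k is in the domain.\<close>
  define y where "y = Max (insert 1 {u. \<exists>x<k. \<alpha> x = Some u})"
  have "{u. \<exists>x<k. \<alpha> x = Some u} \<subseteq> {..k}" using SS'_bounds[OF \<alpha>] by fastforce
  then have fin: "finite (insert 1 {u. \<exists>x<k. \<alpha> x = Some u})" by (simp add: finite_subset)
  have y: "y \<in> insert 1 {u. \<exists>x<k. \<alpha> x = Some u}" unfolding y_def using fin by (rule Max_in) simp
  have y1: "1 \<le> y" unfolding y_def using fin by (rule Max_ge) simp
  have ub: "u \<le> y" if "x < k" "\<alpha> x = Some u" for x u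
    unfolding y_def using fin by (rule Max_ge) (use that in auto)
  have yk: "y \<le> k" using y k SS'_bounds(4)[OF \<alpha>] by fastforce
  have lb: "y \<le> u" if "k < x" "\<alpha> x = Some u" for x u
    using y SS'_bounds(3)[OF \<alpha> that(2)] SS'_mono[OF \<alpha> _ that(2)] that(1) by fastforce
  let ?\<beta> = "\<alpha>(k := Some y)"
  have \<beta>: "?\<beta> \<in> SS' n" using SS'_upd[OF \<alpha> k y1 yk ub lb] .
  have less: "defect n ?\<beta> < defect n \<alpha>" using defect_upd_less[OF k yk] y1 None by simp
  text \<open>For \<open>k = 2\<close>, moving \<open>2\<close> to the forbidden point \<open>1\<close> serves as deletion.\<close>
  let ?g = "if k = 2 then shift n 2 else del n k"
  have "?g \<in> gens n" using k by (auto simp: gens_def)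
  moreover have "\<alpha> x = pt_comp ?g ?\<beta> x" for x
    using k None SS'_bounds[OF \<alpha>, of x] SS'_bounds[OF \<alpha>, of 1]
    by (cases "\<alpha> x"; cases "\<alpha> 1")
      (auto simp: pt_comp_def map_comp_def shift_def del_def idp_def)
  then have "\<alpha> = pt_comp ?g ?\<beta>" by (rule ext)
  ultimately show ?thesis using \<beta> less by blast
qed

text \<open>Lowering k to k - 1 first recovers the value y, which the right factor still takes at k
  - 1. Its value at k may therefore be raised to y + 1, for which \<open>above\<close> leaves
  room.\<close>

lemma split_off_lowering:
  assumes \<alpha>: "\<alpha> \<in> SS' n" and k: "k \<in> {3..n}"
    and Some: "\<alpha> k = Some y" "\<alpha> (k - 1) = Some y"
    and above: "\<And>x u. k < x \<Longrightarrow> \<alpha> x = Some u \<Longrightarrow> y < u"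
  shows "\<exists>g\<in>gens n. \<exists>\<beta>\<in>SS' n. \<alpha> = pt_comp g \<beta> \<and> defect n \<beta> < defect n \<alpha>"
proof -
  let ?\<beta> = "\<alpha>(k := Some (Suc y))"
  have k2: "k \<in> {2..n}" using k by simp
  \<comment> \<open>The bound is read off at k - 1, where y \<le> k - 1; the value at k would give
    only y \<le> k.\<close>
  have yk: "Suc y \<le> k" using SS'_bounds(4)[OF \<alpha> Some(2)] k by auto
  have \<beta>: "?\<beta> \<in> SS' n"
  proof (rule SS'_upd[OF \<alpha> k2 _ yk])
    show "u \<le> Suc y" if "x < k" "\<alpha> x = Some u" for x u
      using SS'_mono[OF \<alpha> that(2) Some(1)] that(1) by simp
    show "Suc y \<le> u" if "k < x" "\<alpha> x = Some u" for x u
      using above[OF that] by simp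
  qed simp
  have "defect n ?\<beta> < defect n \<alpha>" using defect_upd_less[OF k2 yk] Some by simp
  moreover have "low n k \<in> gens n" using k by (simp add: gens_def)
  moreover have "\<alpha> x = pt_comp (low n k) ?\<beta> x" for x
    using k Some SS'_bounds[OF \<alpha>, of x]
    by (cases "\<alpha> x") (auto simp: pt_comp_def map_comp_def low_def idp_def)
  then have "\<alpha> = pt_comp (low n k) ?\<beta>" by (rule ext)
  ultimately show ?thesis using \<beta> by blast
qed

lemma SS'_in_gens_or_factor:
  assumes \<alpha>: "\<alpha> \<in> SS' n" and "n \<ge> 2"
  shows "\<alpha> \<in> gens n \<or> (\<exists>g\<in>gens n. \<exists>\<beta>\<in>SS' n. \<alpha> = pt_comp g \<beta> \<and> defect n \<beta> < defect n \<alpha>)"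
proof (cases "\<exists>k\<in>{2..n}. \<alpha> k = None")
  case True
  then show ?thesis using split_off_deletion[OF \<alpha>] by blast
next
  case total: False
  define K where "K = {x \<in> {3..n}. \<alpha> x = \<alpha> (x - 1)}"
  show ?thesis
  proof (cases "K = {}")
    case True
    have "\<alpha> (Suc x) \<noteq> \<alpha> x" if "2 \<le> x" "Suc x \<le> n" for x
    proof
      assume "\<alpha> (Suc x) = \<alpha> x"
      then have "Suc x \<in> K" using that by (simp add: K_def)
      with True show False by simp
    qed
    then show ?thesis using injective_SS'_in_gens[OF \<alpha> \<open>n \<ge> 2\<close>] total by auto
  next
    case False
    \<comment> \<open>Taking the last collision of neighbours makes the value at k + 1, if k < n,
      strictly larger than the one at k; by isotonicity so are all later values.\<close>
    define k where "k = Max K"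
    have fin: "finite K" by (simp add: K_def)
    have kK: "k \<in> K" using fin False by (simp add: k_def)
    then have k: "k \<in> {3..n}" "\<alpha> k = \<alpha> (k - 1)" by (auto simp: K_def)
    have "\<alpha> k \<noteq> None" using total k(1) by auto
    then obtain y where y: "\<alpha> k = Some y" by blast
    have "y < u" if x: "k < x" "\<alpha> x = Some u" for x u
    proof -
      have "x \<le> n" using SS'_bounds[OF \<alpha> x(2)] by simp
      then have "\<alpha> (Suc k) \<noteq> None" using total x(1) k(1) by auto
      then obtain w where w: "\<alpha> (Suc k) = Some w" by blast
      have "Suc k \<notin> K" using Max_ge[OF fin, of "Suc k"] by (auto simp: k_def)
      then have "w \<noteq> y" using w y k(1) \<open>x \<le> n\<close> x(1) by (auto simp: K_def)
      moreover have "y \<le> w" using SS'_mono[OF \<alpha> y w] by simp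
      moreover have "w \<le> u" using SS'_mono[OF \<alpha> w x(2)] x(1) by simp
      ultimately show ?thesis by simp
    qed
    then show ?thesis using split_off_lowering[OF \<alpha> k(1) y] y k(2) by auto
  qed
qed

lemma gens_generate:
  assumes "n \<ge> 2"
  shows "subsemigroup_gen pt_comp (gens n) = SS' n"
proof
  show "subsemigroup_gen pt_comp (gens n) \<subseteq> SS' n"
    using subsemigroup_gen_subset pt_comp_SS' gens_subset_SS' by metis
  have "\<alpha> \<in> subsemigroup_gen pt_comp (gens n)" if "\<alpha> \<in> SS' n" for \<alpha>
    using that
  \<comment> \<open>The left factor is always a generator, so only the right factor needs the
    induction hypothesis.\<close>
  proof (induction "defect n \<alpha>" arbitrary: \<alpha> rule: less_induct)
    case less
    then show ?case
      using SS'_in_gens_or_factor[OF less.prems assms]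
      by (metis subsemigroup_gen.base subsemigroup_gen.mult)
  qed
  then show "SS' n \<subseteq> subsemigroup_gen pt_comp (gens n)" by blast
qed

theorem theorem3p17:
  fixes n :: nat
  assumes "n \<ge> 2"
  shows "semigroup_rank pt_comp (SS' n) = 3 * n - 4"
  unfolding semigroup_rank_def
proof (rule cInf_eq_minimum)
  show "3 * n - 4 \<in> {card A |A. finite A \<and> A \<subseteq> SS' n \<and> subsemigroup_gen pt_comp A = SS' n}"
    using card_gens[OF assms] finite_gens gens_subset_SS' gens_generate[OF assms]
    by (intro CollectI exI[of _ "gens n"]) simp
next
  fix m assume "m \<in> {card A |A. finite A \<and> A \<subseteq> SS' n \<and> subsemigroup_gen pt_comp A = SS' n}"
  then obtain A where A: "m = card A" "finite A" "A \<subseteq> SS' n" "subsemigroup_gen pt_comp A = SS' n"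
    by blast
  \<comment> \<open>Finiteness of A then turns this inclusion into the lower bound on
    \<open>card A\<close>.\<close>
  have "gens n \<subseteq> A"
  proof
    fix g assume "g \<in> gens n"
    then have "g \<in> subsemigroup_gen pt_comp A" using A(4) gens_subset_SS' by blast
    from pt_comp_SS' gens_irreducible A(3) this \<open>g \<in> gens n\<close> show "g \<in> A"
      by (rule irreducible_in_generating_set)
  qed
  then show "3 * n - 4 \<le> m"
    using card_mono[OF A(2), of "gens n"] card_gens[OF assms] A(1) by simp
qed

end
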